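(* For $k=1,\dots,n-1$, the set $\mathbf\Lambda_k^{\sigma_{n-1}}$ is a disjoint union $\mathbf\Lambda_k^{\sigma_{n-1}}=\mathbf\Lambda_k\cup E_k$, where $$E_k=\left(\mathbf\Lambda_{k+1}\setminus\mathbf\Lambda_k\right)\cap\{A:\sigma_j(A)\,\sigma_n(A)<0\},$$ and where $j=j(A)\in\{0,\dots,n-1\}$ is defined by the condition that $\sigma_j(A)\ne0$ and $\sigma_\ell(A)=0$ for all $j<\ell\le n-1$.
   Context: $\mathrm{Sym}^2(\mathbb R^n)$ is the space of real symmetric $n\times n$ matrices, and $\lambda_1(A)\le\dots\le\lambda_n(A)$ are the ordered eigenvalues of $A$. $\sigma_j(A)$ is the $j$-th elementary symmetric function of the eigenvalues of $A$, with $\sigma_0(A)=1$. For $1\le k\le n$, $\mathbf\Lambda_k:=\{A\in\mathrm{Sym}^2(\mathbb R^n):\lambda_k(A)\ge0\}$. For each $A$ the polynomial $t\mapsto\sigma_{n-1}(tI+A)$ has degree $n-1$ and only real roots; the negatives of its roots, listed in increasing order with multiplicity, are denoted $\lambda_1^{\sigma_{n-1}}(A)\le\dots\le\lambda_{n-1}^{\sigma_{n-1}}(A)$. For $1\le k\le n-1$, $\mathbf\Lambda_k^{\sigma_{n-1}}:=\{A:\lambda_k^{\sigma_{n-1}}(A)\ge0\}$. *)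

theory Defs
  imports "Jordan_Normal_Form.Char_Poly"
begin

definition Sym2 :: "nat \<Rightarrow> real mat set" where
  "Sym2 n = {A \<in> carrier_mat n n. transpose_mat A = A}"

text \<open>Indices of eigenvalues start at 1. A symmetric \<open>n \<times> n\<close> matrix has exactly \<open>n\<close> real
  eigenvalues counted with multiplicity, so the list below has length \<open>n\<close>.\<close>

definition eigval :: "nat \<Rightarrow> real mat \<Rightarrow> real" where
  "eigval i A = sorted_list_of_multiset (proots (char_poly A)) ! (i - 1)"

definition sigma :: "nat \<Rightarrow> real mat \<Rightarrow> real" where
  "sigma j A = (\<Sum>S | S \<subseteq> {1..dim_row A} \<and> card S = j. \<Prod>i\<in>S. eigval i A)"

definition Lam :: "nat \<Rightarrow> nat \<Rightarrow> real mat set" where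
  "Lam n k = {A \<in> Sym2 n. eigval k A \<ge> 0}"

text \<open>The polynomial whose value at every real \<open>t\<close> is \<open>\<sigma>\<^sub>m(tI + A)\<close>. For symmetric \<open>A\<close> it exists,
  as the eigenvalues of \<open>tI + A\<close> are those of \<open>A\<close> translated by \<open>t\<close>; it is unique because a real
  polynomial is determined by its values.\<close>

definition sigma_poly :: "nat \<Rightarrow> real mat \<Rightarrow> real poly" where
  "sigma_poly m A =
     (THE p. \<forall>t. poly p t = sigma m (t \<cdot>\<^sub>m 1\<^sub>m (dim_row A) + A))"

text \<open>The negatives of the roots of \<open>\<sigma>\<^sub>m(tI + A)\<close>, in increasing order with multiplicity,
  again indexed from 1.\<close>

definition sigma_eigval :: "nat \<Rightarrow> nat \<Rightarrow> real mat \<Rightarrow> real" where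
  "sigma_eigval m i A =
     sorted_list_of_multiset (image_mset uminus (proots (sigma_poly m A))) ! (i - 1)"

definition Lam_sigma :: "nat \<Rightarrow> nat \<Rightarrow> real mat set" where
  "Lam_sigma n k = {A \<in> Sym2 n. sigma_eigval (n - 1) k A \<ge> 0}"

text \<open>Such an index exists because \<open>\<sigma>\<^sub>0 = 1\<close>.\<close>

definition last_nonzero :: "real mat \<Rightarrow> nat" where
  "last_nonzero A =
     (THE j. j \<le> dim_row A - 1 \<and> sigma j A \<noteq> 0 \<and>
        (\<forall>l. j < l \<and> l \<le> dim_row A - 1 \<longrightarrow> sigma l A = 0))"

definition E_set :: "nat \<Rightarrow> nat \<Rightarrow> real mat set" where
  "E_set n k = (Lam n (k + 1) - Lam n k) \<inter>
     {A \<in> Sym2 n. sigma (last_nonzero A) A * sigma n A < 0}"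

end

theory Submission
  imports Defs
begin

text \<open>Let \<open>p(t) = \<sigma>\<^sub>n(tI + A) = \<Prod>\<^sub>i (t + \<lambda>\<^sub>i)\<close>, so that \<open>\<sigma>\<^bsub>n-1\<^esub>(tI + A) = p'(t)\<close>, and let \<open>N\<close>, \<open>M\<close> be the
  numbers of positive roots of \<open>p\<close>, \<open>p'\<close>. The \<open>k\<close>-th smallest negated roots of \<open>p\<close>,
  \<open>p'\<close> are nonnegative iff \<open>N < k\<close>, \<open>M < k\<close>, respectively. Counting roots with Rolle's theorem on half-lines gives
  \<open>N - 1 \<le> M \<le> N\<close>, with \<open>M = N\<close> if \<open>p(0) = 0\<close>. It remains to detect \<open>M = N - 1\<close>: the lowest nonzero
  coefficient of a real-rooted polynomial with positive leading coefficient has sign \<open>(-1)\<close> to the number of positive roots,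
  and for \<open>p\<close> (if \<open>\<sigma>\<^sub>n \<noteq> 0\<close>) and \<open>p'\<close> these coefficients are \<open>\<sigma>\<^sub>n\<close> and a positive multiple of
  \<open>\<sigma>\<^sub>j\<close>.\<close>

section \<open>Real-rooted polynomials\<close>

text \<open>Points of \<open>U\<close> that are not roots have order 0. Hence the Rolle argument can
  sum orders in \<open>pderiv p\<close> over all roots of \<open>p\<close>, including simple ones,
  where \<open>pderiv p\<close> does not vanish.\<close>

lemma sum_order_le_size_proots:
  fixes p :: "'a :: idom poly"
  assumes "p \<noteq> 0" "finite U" "\<And>x. x \<in> U \<Longrightarrow> P x"
  shows "(\<Sum>x\<in>U. order x p) \<le> size (filter_mset P (proots p))"
proof -
  let ?M = "filter_mset P (proots p)"
  have "(\<Sum>x\<in>U. order x p) = (\<Sum>x\<in>U. count ?M x)"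
    using assms by (intro sum.cong) auto
  also have "\<dots> \<le> (\<Sum>x\<in>U \<union> set_mset ?M. count ?M x)"
    using assms(2) by (intro sum_mono2) auto
  also have "\<dots> = (\<Sum>x\<in>set_mset ?M. count ?M x)"
    using assms(2) by (intro sum.mono_neutral_right) (auto simp only: not_in_iff finite_UnI finite_set_mset)
  also have "\<dots> = size ?M"
    by (simp add: size_multiset_overloaded_eq)
  finally show ?thesis .
qed

lemma size_filter_proots:
  fixes p :: "'a :: idom poly"
  assumes "p \<noteq> 0"
  shows "size (filter_mset P (proots p)) = (\<Sum>x | P x \<and> poly p x = 0. order x p)"
  using assms by (auto simp: size_multiset_overloaded_eq intro!: sum.cong)

text \<open>A root of multiplicity \<open>m\<close> is a root of multiplicity \<open>m - 1\<close> of the derivative, and Rolle's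
  theorem gives one more root in each gap between consecutive roots.\<close>

lemma size_proots_pderiv_Rolle:
  fixes p :: "real poly"
  assumes "pderiv p \<noteq> 0" and conv: "\<And>a b x. P a \<Longrightarrow> P b \<Longrightarrow> a < x \<Longrightarrow> x < b \<Longrightarrow> P x"
  shows "size (filter_mset P (proots p)) \<le> Suc (size (filter_mset P (proots (pderiv p))))"
proof -
  have p: "p \<noteq> 0" using assms(1) by auto
  define R where "R = {x. P x \<and> poly p x = 0}"
  have fin: "finite R"
    using poly_roots_finite[OF p] by (rule finite_subset[rotated]) (auto simp: R_def)
  show ?thesis
  proof (cases "R = {}")
    case True
    then have "(\<Sum>x | P x \<and> poly p x = 0. order x p) = 0"
      unfolding R_def by (simp only: sum.empty)
    then show ?thesis unfolding size_filter_proots[OF p] by (simp only: zero_le)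
  next
    case False
    \<comment> \<open>The root following \<open>r\<close>. It exists for every \<open>r\<close> in
      \<open>R\<close> except \<open>Max R\<close>, so there is one gap fewer than there are
      roots.\<close>
    define nxt where "nxt r = Min {x \<in> R. r < x}" for r
    have nxt: "nxt r \<in> R" "r < nxt r" "\<And>x. x \<in> R \<Longrightarrow> r < x \<Longrightarrow> nxt r \<le> x"
      if "r \<in> R - {Max R}" for r
    proof -
      have "r < Max R" using that fin by (simp add: order.not_eq_order_implies_strict)
      then have ne: "{x \<in> R. r < x} \<noteq> {}" using Max_in[OF fin False] by auto
      have "nxt r \<in> {x \<in> R. r < x}" unfolding nxt_def using fin ne by (intro Min_in) auto
      then show "nxt r \<in> R" "r < nxt r" by auto
      show "nxt r \<le> x" if "x \<in> R" "r < x" for x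
        unfolding nxt_def using fin that by (intro Min_le) auto
    qed
    have "\<exists>x. r < x \<and> x < nxt r \<and> poly (pderiv p) x = 0" if r: "r \<in> R - {Max R}" for r
    proof -
      obtain x where x: "r < x" "x < nxt r"
        "poly p (nxt r) - poly p r = (nxt r - r) * poly (pderiv p) x"
        using poly_MVT[OF nxt(2)[OF r]] by blast
      then have "poly (pderiv p) x = 0" using nxt(1,2)[OF r] r by (simp add: R_def)
      then show ?thesis using x by blast
    qed
    then obtain f where f: "\<And>r. r \<in> R - {Max R} \<Longrightarrow>
        r < f r \<and> f r < nxt r \<and> poly (pderiv p) (f r) = 0" by metis
    \<comment> \<open>Rolle points of different gaps are separated by a root:
      \<open>f r < nxt r \<le> s < f s\<close>.\<close>
    have mono: "f r < f s" if "r \<in> R - {Max R}" "s \<in> R - {Max R}" "r < s" for r s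
      using f[OF that(1)] f[OF that(2)] nxt(3)[OF that(1), of s] that by force
    have inj: "inj_on f (R - {Max R})"
    proof (rule inj_onI)
      fix r s assume "r \<in> R - {Max R}" "s \<in> R - {Max R}" "f r = f s"
      then show "r = s" using mono[of r s] mono[of s r] by (cases r s rule: linorder_cases) auto
    qed
    define T where "T = f ` (R - {Max R})"
    have T: "x \<notin> R \<and> P x \<and> poly (pderiv p) x = 0" if x: "x \<in> T" for x
    proof -
      obtain r where r: "r \<in> R - {Max R}" "x = f r" using x unfolding T_def by blast
      have "x \<notin> R" using nxt(3)[OF r(1), of x] f[OF r(1)] r by auto
      moreover have "P x"
        by (rule conv[of r "nxt r"]) (use nxt(1)[OF r(1)] f[OF r(1)] r in \<open>auto simp: R_def\<close>)
      ultimately show ?thesis using f[OF r(1)] r by auto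
    qed
    have finT: "finite T" using fin by (simp add: T_def)
    have cT: "Suc (card T) = card R"
      unfolding T_def using card_image[OF inj] fin False
      by (metis Max_in card_Suc_Diff1)
    have "card T = (\<Sum>x\<in>T. 1)" by simp
    also have "\<dots> \<le> (\<Sum>x\<in>T. order x (pderiv p))"
      using T assms(1) by (intro sum_mono) (auto simp: order_gt_0_iff Suc_le_eq)
    finally have T_le: "card T \<le> (\<Sum>x\<in>T. order x (pderiv p))" .
    \<comment> \<open>Each root in \<open>R\<close> loses one order in \<open>pderiv p\<close>, a
      total loss of \<open>card R\<close>. The points of \<open>T\<close>, one per gap and disjoint
      from \<open>R\<close>, recover all but one of it.\<close>
    have "size (filter_mset P (proots p)) = (\<Sum>x\<in>R. order x p)"
      using p by (simp add: size_filter_proots R_def)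
    also have "\<dots> = (\<Sum>x\<in>R. Suc (order x (pderiv p)))"
      using order_pderiv[OF p] by (intro sum.cong) (auto simp: R_def)
    also have "\<dots> = card R + (\<Sum>x\<in>R. order x (pderiv p))"
      by (simp add: sum_Suc)
    also have "\<dots> \<le> Suc ((\<Sum>x\<in>R. order x (pderiv p)) + (\<Sum>x\<in>T. order x (pderiv p)))"
      using T_le cT by simp
    also have "\<dots> = Suc (\<Sum>x\<in>R \<union> T. order x (pderiv p))"
      using fin finT T by (subst sum.union_disjoint) auto
    also have "\<dots> \<le> Suc (size (filter_mset P (proots (pderiv p))))"
      using fin finT T assms(1)
      by (intro Suc_le_mono[THEN iffD2] sum_order_le_size_proots) (auto simp: R_def)
    finally show ?thesis .
  qed
qed

section \<open>Splitting into linear factors\<close>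

lemma real_rooted_factorization:
  fixes p :: "'a :: field poly"
  assumes "size (proots p) = degree p"
  shows "p = Polynomial.smult (lead_coeff p) (\<Prod>x\<in>#proots p. [:-x, 1:])"
  using assms
proof (induction "degree p" arbitrary: p)
  case 0
  then obtain c where "p = [:c:]" by (metis degree_eq_zeroE)
  then show ?case by simp
next
  case (Suc d)
  then have p: "p \<noteq> 0" by auto
  from Suc have "proots p \<noteq> {#}" by auto
  then obtain r where "r \<in># proots p" by blast
  then have "poly p r = 0" using p by simp
  then obtain q where q: "p = [:-r, 1:] * q" by (metis poly_eq_0_iff_dvd dvdE)
  then have [simp]: "q \<noteq> 0" using p by auto
  have pr: "proots p = add_mset r (proots q)"
    unfolding q by (subst proots_mult) auto
  have dq: "degree p = Suc (degree q)" unfolding q by (subst degree_mult_eq) auto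
  have "q = Polynomial.smult (lead_coeff q) (\<Prod>x\<in>#proots q. [:-x, 1:])"
    using Suc dq pr by simp
  moreover have "lead_coeff p = lead_coeff q" unfolding q by (subst lead_coeff_mult) simp
  ultimately have *: "q = Polynomial.smult (lead_coeff p) (\<Prod>x\<in>#proots q. [:-x, 1:])"
    by simp
  have "[:-r, 1:] * Polynomial.smult (lead_coeff p) (\<Prod>x\<in>#proots q. [:-x, 1:])
      = Polynomial.smult (lead_coeff p) (\<Prod>x\<in>#proots p. [:-x, 1:])"
    unfolding pr image_mset_add_mset prod_mset.add_mset mult_smult_right ..
  then show ?case using q * by metis
qed

text \<open>The fundamental theorem of algebra supplies a complex root, which is real by assumption,
  so a real linear factor splits off. Complex roots of the quotient are roots of \<open>p\<close>,
  so the induction continues.\<close>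

lemma real_rooted_if_complex_roots_real:
  fixes p :: "real poly"
  assumes "p \<noteq> 0" and "\<And>z. poly (map_poly complex_of_real p) z = 0 \<Longrightarrow> z \<in> \<real>"
  shows "size (proots p) = degree p"
  using assms
proof (induction "degree p" arbitrary: p)
  case 0
  then show ?case using size_proots_le[of p] by simp
next
  interpret cpoly: map_poly_comm_ring_hom complex_of_real ..
  case (Suc d)
  have "degree (map_poly complex_of_real p) \<noteq> 0" using Suc(2) by simp
  then obtain z where z: "poly (map_poly complex_of_real p) z = 0"
    using fundamental_theorem_of_algebra constant_degree by metis
  then obtain r where "z = complex_of_real r" using Suc.prems(2) by (metis Reals_cases)
  with z have "poly p r = 0" by simp
  then obtain q where q: "p = [:-r, 1:] * q" by (metis poly_eq_0_iff_dvd dvdE)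
  then have [simp]: "q \<noteq> 0" using Suc by auto
  have dq: "degree p = Suc (degree q)" unfolding q by (subst degree_mult_eq) auto
  have "z \<in> \<real>" if "poly (map_poly complex_of_real q) z = 0" for z
    using Suc.prems(2)[of z] that unfolding q by (simp only: cpoly.hom_mult poly_mult mult_zero_right)
  then have "size (proots q) = degree q" using Suc dq by simp
  moreover have "proots p = add_mset r (proots q)"
    unfolding q by (subst proots_mult) auto
  ultimately show ?case using dq by simp
qed

lemma proots_prod_linear:
  fixes M :: "'a :: idom multiset"
  shows "proots (\<Prod>x\<in>#M. [:x, 1:]) = image_mset uminus M"
  by (induction M) (auto simp: proots_mult prod_mset_zero_iff image_iff simp del: mult_pCons_left)

lemma degree_prod_linear: "degree (\<Prod>x\<in>#M. [:x, 1:] :: 'a :: idom poly) = size M"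
  by (induction M) (auto simp: degree_mult_eq prod_mset_zero_iff image_iff simp del: mult_pCons_left)

lemma lead_coeff_prod_linear: "lead_coeff (\<Prod>x\<in>#M. [:x, 1:] :: 'a :: idom poly) = 1"
  by (induction M) (auto simp: lead_coeff_mult simp del: mult_pCons_left)

text \<open>Multiplication by \<open>t - x\<close> moves the lowest nonzero coefficient up one place
  if \<open>x = 0\<close>; otherwise it scales it by \<open>- x\<close>, flipping its sign exactly
  when \<open>x > 0\<close>.\<close>

lemma sgn_lowest_coeff:
  fixes M :: "real multiset"
  obtains m where "\<And>i. i < m \<Longrightarrow> coeff (\<Prod>x\<in>#M. [:-x, 1:]) i = 0"
    and "sgn (coeff (\<Prod>x\<in>#M. [:-x, 1:]) m) = (-1) ^ size {#x \<in># M. x > 0#}"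
proof (induction M arbitrary: thesis)
  case empty
  show ?case by (rule empty[of 0]) auto
next
  case (add x M)
  let ?p = "\<Prod>x\<in>#M. [:-x, 1:]"
  obtain m where m: "\<And>i. i < m \<Longrightarrow> coeff ?p i = 0"
    "sgn (coeff ?p m) = (-1) ^ size {#x \<in># M. x > 0#}" using add.IH by blast
  show ?case
  proof (cases "x = 0")
    case True
    show ?thesis
      by (rule add.prems[of "Suc m"]) (use True m in \<open>auto simp: coeff_pCons split: nat.splits\<close>)
  next
    case False
    show ?thesis
    proof (rule add.prems[of m])
      show "coeff (\<Prod>x\<in>#add_mset x M. [:-x, 1:]) i = 0" if "i < m" for i
        using m(1) that by (auto simp: coeff_pCons split: nat.splits)
      have "coeff (\<Prod>x\<in>#add_mset x M. [:-x, 1:]) m = - x * coeff ?p m"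
        using m(1) by (auto simp: coeff_pCons split: nat.splits)
      then show "sgn (coeff (\<Prod>x\<in>#add_mset x M. [:-x, 1:]) m)
          = (-1) ^ size {#x \<in># add_mset x M. x > 0#}"
        using m(2) False by (simp add: sgn_mult)
    qed
  qed
qed

section \<open>Positive roots of a real-rooted polynomial and of its derivative\<close>

locale real_rooted_poly =
  fixes p :: "real poly"
  assumes real_rooted: "size (proots p) = degree p" and degree_pos: "0 < degree p"
begin

lemma pderiv_nonzero: "pderiv p \<noteq> 0"
  using degree_pos by (simp add: pderiv_eq_0_iff)

text \<open>Rolle on the whole line loses at most one root, and the degree drops by exactly
  one.\<close>

lemma pderiv_real_rooted: "size (proots (pderiv p)) = degree (pderiv p)"
  using size_proots_pderiv_Rolle[OF pderiv_nonzero, of "\<lambda>_. True"] real_rooted degree_pos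
    size_proots_le[of "pderiv p"] by (simp add: degree_pderiv)

lemma positive_roots_le: "size {#x \<in># proots p. x > 0#} \<le> Suc (size {#x \<in># proots (pderiv p). x > 0#})"
  by (rule size_proots_pderiv_Rolle[OF pderiv_nonzero]) auto

text \<open>Rolle on the complementary half-line bounds the nonpositive roots; subtracting from the
  total root counts, which differ by one, reverses the inequality.\<close>

lemma positive_roots_ge: "size {#x \<in># proots (pderiv p). x > 0#} \<le> size {#x \<in># proots p. x > 0#}"
proof -
  have *: "size {#x \<in># M. x > 0#} + size {#x \<in># M. \<not> x > 0#} = size M" for M :: "real multiset"
    by (metis multiset_partition size_union)
  have "size {#x \<in># proots p. \<not> x > 0#} \<le> Suc (size {#x \<in># proots (pderiv p). \<not> x > 0#})"
    by (rule size_proots_pderiv_Rolle[OF pderiv_nonzero]) auto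
  then show ?thesis
    using *[of "proots p"] *[of "proots (pderiv p)"] real_rooted pderiv_real_rooted degree_pos
    by (simp add: degree_pderiv)
qed

text \<open>Rolle on the closed half-line allows a loss of one root, and the order at 0 already
  accounts for it: it drops by exactly one.\<close>

lemma positive_roots_eq_if_zero_root:
  assumes "poly p 0 = 0"
  shows "size {#x \<in># proots (pderiv p). x > 0#} = size {#x \<in># proots p. x > 0#}"
proof -
  have p: "p \<noteq> 0" using degree_pos by auto
  have *: "size {#x \<in># M. x \<ge> 0#} = size {#x \<in># M. x > 0#} + count M 0" for M :: "real multiset"
    by (induction M) auto
  have "size {#x \<in># proots p. x \<ge> 0#} \<le> Suc (size {#x \<in># proots (pderiv p). x \<ge> 0#})"
    by (rule size_proots_pderiv_Rolle[OF pderiv_nonzero]) auto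
  then show ?thesis
    using order_pderiv[OF p assms] positive_roots_ge p pderiv_nonzero unfolding * by simp
qed

lemma sgn_lowest_coeff_pderiv:
  assumes "lead_coeff p > 0"
  obtains m where "\<And>i. i < m \<Longrightarrow> coeff (pderiv p) i = 0"
    and "sgn (coeff (pderiv p) m) = (-1) ^ size {#x \<in># proots (pderiv p). x > 0#}"
proof -
  have l: "lead_coeff (pderiv p) > 0"
    using assms degree_pos by (simp add: degree_pderiv coeff_pderiv)
  obtain m where m: "\<And>i. i < m \<Longrightarrow> coeff (\<Prod>x\<in>#proots (pderiv p). [:-x, 1:]) i = 0"
    "sgn (coeff (\<Prod>x\<in>#proots (pderiv p). [:-x, 1:]) m)
       = (-1) ^ size {#x \<in># proots (pderiv p). x > 0#}"
    using sgn_lowest_coeff by blast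
  define c where "c = lead_coeff (pderiv p)"
  have "coeff (pderiv p) i = c * coeff (\<Prod>x\<in>#proots (pderiv p). [:-x, 1:]) i" for i
    unfolding c_def
    by (rule arg_cong[OF real_rooted_factorization[OF pderiv_real_rooted],
          of "\<lambda>q. coeff q i", unfolded coeff_smult])
  then show ?thesis
    using m l[folded c_def] by (intro that[of m]) (auto simp: sgn_mult)
qed

lemma sgn_poly_0:
  assumes "lead_coeff p > 0" "poly p 0 \<noteq> 0"
  shows "sgn (poly p 0) = (-1) ^ size {#x \<in># proots p. x > 0#}"
proof -
  let ?q = "\<Prod>x\<in>#proots p. [:-x, 1:]"
  define c where "c = lead_coeff p"
  have c: "c > 0" using assms(1) by (simp add: c_def)
  have eq: "poly p 0 = c * coeff ?q 0"
    unfolding poly_0_coeff_0 c_def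
    by (rule arg_cong[OF real_rooted_factorization[OF real_rooted],
          of "\<lambda>q. coeff q 0", unfolded coeff_smult])
  obtain m where m: "\<And>i. i < m \<Longrightarrow> coeff ?q i = 0"
    "sgn (coeff ?q m) = (-1) ^ size {#x \<in># proots p. x > 0#}"
    using sgn_lowest_coeff by blast
  \<comment> \<open>A positive \<open>m\<close> would make the constant coefficient vanish,
    contradicting \<open>poly p 0 \<noteq> 0\<close>.\<close>
  have "m = 0" using m(1)[of 0] eq assms(2) by auto
  then show ?thesis using m(2) eq c by (simp add: sgn_mult)
qed

end

section \<open>Elementary symmetric functions\<close>

text \<open>Expanding the product means choosing a set \<open>S\<close> of factors that contribute
  their constant \<open>f i\<close>; the others contribute the variable, giving degree
  \<open>card I - card S\<close>.\<close>

lemma coeff_prod_linear: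
  fixes f :: "'a \<Rightarrow> 'b :: comm_ring_1"
  assumes "finite I" "j \<le> card I"
  shows "coeff (\<Prod>i\<in>I. [:f i, 1:]) (card I - j) = (\<Sum>S | S \<subseteq> I \<and> card S = j. \<Prod>i\<in>S. f i)"
proof -
  have summand: "(\<Prod>i\<in>S. [:f i:]) * (\<Prod>i\<in>I - S. monom 1 1) = monom (\<Prod>i\<in>S. f i) (card I - card S)"
    if "S \<subseteq> I" for S
  proof -
    have "(\<Prod>i\<in>S. [:f i:]) = [:\<Prod>i\<in>S. f i:]"
      by (induction S rule: infinite_finite_induct) (auto simp: one_pCons)
    moreover have "(\<Prod>i\<in>I - S. monom 1 1 :: 'b poly) = monom 1 (card I - card S)"
      using that assms(1) by (simp add: monom_power card_Diff_subset finite_subset)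
    ultimately show ?thesis by (simp add: smult_monom)
  qed
  have "(\<Prod>i\<in>I. [:f i, 1:]) = (\<Prod>i\<in>I. [:f i:] + monom 1 1)"
    by (simp add: monom_altdef)
  also have "\<dots> = (\<Sum>S\<in>Pow I. (\<Prod>i\<in>S. [:f i:]) * (\<Prod>i\<in>I - S. monom 1 1))"
    by (rule prod_add[OF assms(1)])
  also have "\<dots> = (\<Sum>S\<in>Pow I. monom (\<Prod>i\<in>S. f i) (card I - card S))"
    by (intro sum.cong refl summand) auto
  finally have "coeff (\<Prod>i\<in>I. [:f i, 1:]) (card I - j)
      = (\<Sum>S\<in>Pow I. if card I - card S = card I - j then \<Prod>i\<in>S. f i else 0)"
    by (simp add: coeff_sum)
  also have "\<dots> = (\<Sum>S\<in>Pow I. if card S = j then \<Prod>i\<in>S. f i else 0)"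
  proof (intro sum.cong refl)
    fix S assume "S \<in> Pow I"
    then have "card S \<le> card I" using assms(1) by (auto intro: card_mono)
    then have "card I - card S = card I - j \<longleftrightarrow> card S = j" using assms(2) by auto
    then show "(if card I - card S = card I - j then \<Prod>i\<in>S. f i else 0)
        = (if card S = j then \<Prod>i\<in>S. f i else 0)" by simp
  qed
  also have "\<dots> = (\<Sum>S | S \<subseteq> I \<and> card S = j. \<Prod>i\<in>S. f i)"
    using assms(1) by (subst sum.inter_filter[symmetric]) (auto intro: sum.cong)
  finally show ?thesis .
qed

text \<open>The negative entries of a sorted list form an initial segment, so their number is the
  first position of a nonnegative entry, if there is one.\<close>

lemma sorted_nth_nonneg_iff:
  fixes xs :: "'a :: {linorder, zero} list"
  assumes "sorted xs" "i < length xs"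
  shows "xs ! i \<ge> 0 \<longleftrightarrow> length (filter (\<lambda>x. x < 0) xs) \<le> i"
  using assms
proof (induction xs arbitrary: i)
  case (Cons x xs)
  show ?case
  proof (cases "x < 0")
    case True
    then show ?thesis using Cons by (cases i) auto
  next
    case False
    then have "\<forall>y\<in>set (x # xs). \<not> y < 0" using Cons.prems by auto
    then show ?thesis using Cons.prems by (metis filter_False le0 list.size(3) not_less nth_mem)
  qed
qed simp

lemma sorted_list_of_multiset_nth_nonneg_iff:
  fixes M :: "'a :: {linorder, zero} multiset"
  assumes "1 \<le> k" "k \<le> size M"
  shows "sorted_list_of_multiset M ! (k - 1) \<ge> 0 \<longleftrightarrow> size {#x \<in># M. x < 0#} < k"
proof -
  let ?xs = "sorted_list_of_multiset M"
  have "length ?xs = size M" by (metis mset_sorted_list_of_multiset size_mset)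
  moreover have "length (filter (\<lambda>x. x < 0) ?xs) = size {#x \<in># M. x < 0#}"
    by (metis mset_filter mset_sorted_list_of_multiset size_mset)
  ultimately show ?thesis using sorted_nth_nonneg_iff[of ?xs "k - 1"] assms by auto
qed

section \<open>Symmetric matrices\<close>

text \<open>The Hermitian argument: moving the real symmetric matrix across the inner product gives
  \<open>z * (v \<bullet>c v) = cnj z * (v \<bullet>c v)\<close>, and \<open>v \<bullet>c v\<close>
  is nonzero.\<close>

lemma eigenvalue_complex_of_Sym2_real:
  assumes "A \<in> Sym2 n" "eigenvalue (map_mat complex_of_real A) z"
  shows "z \<in> \<real>"
proof -
  let ?B = "map_mat complex_of_real A"
  have A: "A \<in> carrier_mat n n" and sym: "transpose_mat A = A" using assms by (auto simp: Sym2_def)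
  have B: "?B \<in> carrier_mat n n" using A by simp
  obtain v where v: "v \<in> carrier_vec n" "v \<noteq> 0\<^sub>v n" "?B *\<^sub>v v = z \<cdot>\<^sub>v v"
    using assms(2) A by (auto simp: eigenvalue_def eigenvector_def)
  have sym_entry: "A $$ (i, j) = A $$ (j, i)" if "i < n" "j < n" for i j
    using sym that A by (metis carrier_matD index_transpose_mat(1))
  have cB: "conjugate (?B *\<^sub>v v) = ?B *\<^sub>v conjugate v"
  proof (rule eq_vecI)
    fix i assume "i < dim_vec (?B *\<^sub>v conjugate v)"
    then show "conjugate (?B *\<^sub>v v) $ i = (?B *\<^sub>v conjugate v) $ i"
      using A v(1) by (simp add: scalar_prod_def)
  qed (use A in auto)
  have tB: "transpose_mat ?B = ?B" using A by (intro eq_matI) (auto simp: sym_entry)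
  have cv: "conjugate v \<in> carrier_vec n" using v by simp
  have "z * (v \<bullet>c v) = (?B *\<^sub>v v) \<bullet> conjugate v"
    using v cv by simp
  also have "\<dots> = v \<bullet> (?B *\<^sub>v conjugate v)"
    by (metis B tB v(1) cv transpose_vec_mult_scalar comm_scalar_prod mult_mat_vec_carrier)
  also have "\<dots> = v \<bullet> conjugate (z \<cdot>\<^sub>v v)" using cB v(3) by simp
  also have "\<dots> = cnj z * (v \<bullet>c v)" using v cv by (simp add: conjugate_smult_vec)
  finally have "z * (v \<bullet>c v) = cnj z * (v \<bullet>c v)" .
  moreover have "v \<bullet>c v \<noteq> 0" using v by simp
  ultimately have "z = cnj z" by simp
  then show ?thesis by (metis Reals_cnj_iff)
qed

context
  fixes n :: nat and A :: "real mat"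
  assumes A: "A \<in> Sym2 n"
begin

lemma size_proots_char_poly: "size (proots (char_poly A)) = n"
proof -
  have c: "A \<in> carrier_mat n n" using A by (simp add: Sym2_def)
  then have d: "degree (char_poly A) = n" "coeff (char_poly A) n = 1"
    using degree_monic_char_poly by auto
  have "size (proots (char_poly A)) = degree (char_poly A)"
  proof (rule real_rooted_if_complex_roots_real)
    show "char_poly A \<noteq> 0" using d by auto
    fix z assume "poly (map_poly complex_of_real (char_poly A)) z = 0"
    then have "eigenvalue (map_mat complex_of_real A) z"
      using c by (simp add: eigenvalue_root_char_poly[of _ n] of_real_hom.char_poly_hom[OF c])
    then show "z \<in> \<real>" using eigenvalue_complex_of_Sym2_real[OF A] by blast
  qed
  then show ?thesis using d by simp
qed

lemma char_poly_factorization: "char_poly A = (\<Prod>x\<in>#proots (char_poly A). [:-x, 1:])"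
proof -
  have c: "A \<in> carrier_mat n n" using A by (simp add: Sym2_def)
  show ?thesis
    using real_rooted_factorization[of "char_poly A"] size_proots_char_poly
      degree_monic_char_poly[OF c] by simp
qed

lemma Sym2_shift: "t \<cdot>\<^sub>m 1\<^sub>m n + A \<in> Sym2 n"
proof -
  have c: "A \<in> carrier_mat n n" and s: "transpose_mat A = A" using A by (auto simp: Sym2_def)
  have "A $$ (i, j) = A $$ (j, i)" if "i < n" "j < n" for i j
    using s that c by (metis carrier_matD index_transpose_mat(1))
  then show ?thesis using c by (auto simp: Sym2_def intro!: eq_matI)
qed

text \<open>The characteristic matrix of \<open>tI + A\<close> at \<open>y\<close> is that of
  \<open>A\<close> at \<open>y - t\<close>. Comparing values at all \<open>y\<close> gives the
  factorization, hence the roots with multiplicity.\<close>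

lemma proots_char_poly_shift:
  "proots (char_poly (t \<cdot>\<^sub>m 1\<^sub>m n + A)) = image_mset (\<lambda>x. t + x) (proots (char_poly A))"
proof -
  have c: "A \<in> carrier_mat n n" using A by (simp add: Sym2_def)
  then have c': "t \<cdot>\<^sub>m 1\<^sub>m n + A \<in> carrier_mat n n" by simp
  have "poly (char_poly (t \<cdot>\<^sub>m 1\<^sub>m n + A)) y = poly (char_poly A) (y - t)" for y
    unfolding char_poly_matrix[OF c'] char_poly_matrix[OF c]
    using c by (intro arg_cong[of _ _ det] eq_matI) (auto simp: char_matrix_def algebra_simps)
  also have "poly (char_poly A) (y - t) = (\<Prod>x\<in>#proots (char_poly A). y - t - x)" for y
    by (subst char_poly_factorization) (simp add: poly_prod_mset image_mset.compositionality o_def)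
  also have "(\<Prod>x\<in>#proots (char_poly A). y - t - x)
      = poly (\<Prod>x\<in>#image_mset (\<lambda>x. - (t + x)) (proots (char_poly A)). [:x, 1:]) y" for y
    by (simp add: poly_prod_mset image_mset.compositionality o_def algebra_simps)
  finally have "char_poly (t \<cdot>\<^sub>m 1\<^sub>m n + A)
      = (\<Prod>x\<in>#image_mset (\<lambda>x. - (t + x)) (proots (char_poly A)). [:x, 1:])"
    by (simp add: poly_eq_poly_eq_iff[symmetric] fun_eq_iff)
  then show ?thesis
    by (simp only: proots_prod_linear) (simp add: image_mset.compositionality o_def add.commute)
qed

end

section \<open>The determinant polynomial, its coefficients and its derivative\<close>

text \<open>The polynomial \<open>\<sigma>\<^sub>n(tI + A)\<close> in \<open>t\<close>.\<close>

definition det_poly :: "real mat \<Rightarrow> real poly" where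
  "det_poly A = (\<Prod>x\<in>#proots (char_poly A). [:x, 1:])"

text \<open>Vieta's formula, once the product over the multiset of eigenvalues is rewritten as a
  product over the indices of the sorted list, shifted to start at 1.\<close>

lemma sigma_eq_coeff:
  assumes "A \<in> Sym2 n" "j \<le> n"
  shows "sigma j A = coeff (det_poly A) (n - j)"
proof -
  let ?xs = "sorted_list_of_multiset (proots (char_poly A))"
  have len: "length ?xs = n"
    by (metis assms(1) mset_sorted_list_of_multiset size_mset size_proots_char_poly)
  have dim: "dim_row A = n" using assms(1) by (auto simp: Sym2_def)
  have "det_poly A = (\<Prod>x\<leftarrow>?xs. [:x, 1:])"
    unfolding det_poly_def
    by (metis mset_map mset_sorted_list_of_multiset prod_mset_prod_list)
  also have "\<dots> = (\<Prod>i = 0..<n. [:?xs ! i, 1:])"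
    using len by (simp add: prod.list_conv_set_nth)
  also have "\<dots> = (\<Prod>i\<in>{1..n}. [:eigval i A, 1:])"
    unfolding eigval_def
    by (rule prod.reindex_bij_witness[of _ "\<lambda>i. i - 1" Suc]) auto
  finally show ?thesis
    using coeff_prod_linear[of "{1..n}" j "\<lambda>i. eigval i A"] assms(2) dim by (simp add: sigma_def)
qed

lemma det_poly_shift:
  assumes "A \<in> Sym2 n"
  shows "det_poly (t \<cdot>\<^sub>m 1\<^sub>m n + A) = pcompose (det_poly A) [:t, 1:]"
proof -
  have "poly (det_poly (t \<cdot>\<^sub>m 1\<^sub>m n + A)) y = poly (pcompose (det_poly A) [:t, 1:]) y" for y
    by (simp add: det_poly_def proots_char_poly_shift[OF assms] poly_pcompose poly_prod_mset
        image_mset.compositionality o_def algebra_simps)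
  then show ?thesis by (simp add: poly_eq_poly_eq_iff[symmetric] fun_eq_iff)
qed

text \<open>The value of \<open>sigma (n - 1)\<close> at \<open>tI + A\<close> is the linear
  coefficient in \<open>y\<close> of \<open>det_poly A\<close> at \<open>y + t\<close>, which by
  Taylor expansion is the derivative at \<open>t\<close>.\<close>

lemma sigma_poly_eq_pderiv:
  assumes "A \<in> Sym2 n" "0 < n"
  shows "sigma_poly (n - 1) A = pderiv (det_poly A)"
proof -
  have dim: "dim_row A = n" using assms(1) by (auto simp: Sym2_def)
  have val: "sigma (n - 1) (t \<cdot>\<^sub>m 1\<^sub>m (dim_row A) + A) = poly (pderiv (det_poly A)) t" for t
  proof -
    have "sigma (n - 1) (t \<cdot>\<^sub>m 1\<^sub>m n + A) = coeff (pcompose (det_poly A) [:t, 1:]) 1"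
      using sigma_eq_coeff[OF Sym2_shift[OF assms(1)], of "n - 1" t] assms(2)
      by (simp add: det_poly_shift[OF assms(1)])
    also have "\<dots> = poly (pderiv (pcompose (det_poly A) [:t, 1:])) 0"
      by (simp add: poly_0_coeff_0 coeff_pderiv)
    also have "\<dots> = poly (pderiv (det_poly A)) t"
      by (simp add: pderiv_pcompose poly_pcompose pderiv_pCons)
    finally show ?thesis using dim by simp
  qed
  show ?thesis
    unfolding sigma_poly_def val
    by (rule the_equality) (auto simp: poly_eq_poly_eq_iff fun_eq_iff[symmetric])
qed

lemma last_nonzero_eq:
  assumes "A \<in> Sym2 n" "j \<le> n - 1" "sigma j A \<noteq> 0"
    and "\<And>l. j < l \<Longrightarrow> l \<le> n - 1 \<Longrightarrow> sigma l A = 0"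
  shows "last_nonzero A = j"
proof -
  have dim: "dim_row A = n" using assms(1) by (auto simp: Sym2_def)
  show ?thesis
    unfolding last_nonzero_def dim
  proof (rule the_equality)
    fix i assume "i \<le> n - 1 \<and> sigma i A \<noteq> 0 \<and> (\<forall>l. i < l \<and> l \<le> n - 1 \<longrightarrow> sigma l A = 0)"
    then show "i = j" using assms by (metis linorder_neqE_nat)
  qed (use assms in auto)
qed

theorem proposition1p1:
  fixes n k :: nat
  assumes "1 \<le> k" and "k \<le> n - 1"
  shows "Lam_sigma n k = Lam n k \<union> E_set n k \<and> Lam n k \<inter> E_set n k = {}"
proof -
  have "A \<in> Lam_sigma n k \<longleftrightarrow> A \<in> Lam n k \<union> E_set n k" if A: "A \<in> Sym2 n" for A
  proof -
    have n: "0 < n" using assms by simp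
    define p where "p = det_poly A"
    define N where "N = size {#x \<in># proots p. x > 0#}"
    define M where "M = size {#x \<in># proots (pderiv p). x > 0#}"
    have deg: "degree p = n" "lead_coeff p = 1"
      using degree_prod_linear lead_coeff_prod_linear size_proots_char_poly[OF A]
      by (auto simp: p_def det_poly_def)
    have pr: "proots p = image_mset uminus (proots (char_poly A))"
      unfolding p_def det_poly_def by (rule proots_prod_linear)
    interpret real_rooted_poly p
      by unfold_locales (use deg n pr size_proots_char_poly[OF A] in auto)
    \<comment> \<open>Roots of \<open>p\<close> are negated eigenvalues, so \<open>N\<close> counts
      the negative eigenvalues.\<close>
    have lam: "A \<in> Lam n i \<longleftrightarrow> N < i" if "1 \<le> i" "i \<le> n" for i
      using sorted_list_of_multiset_nth_nonneg_iff[of i "proots (char_poly A)"] that A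
        size_proots_char_poly[OF A]
      by (simp add: Lam_def eigval_def N_def pr filter_mset_image_mset)
    have sp: "sigma_poly (n - 1) A = pderiv p"
      unfolding p_def by (rule sigma_poly_eq_pderiv[OF A n])
    have "A \<in> Lam_sigma n k \<longleftrightarrow> sigma_eigval (n - 1) k A \<ge> 0"
      using A by (simp add: Lam_sigma_def)
    then have mu: "A \<in> Lam_sigma n k \<longleftrightarrow> M < k"
      using sorted_list_of_multiset_nth_nonneg_iff[of k "image_mset uminus (proots (pderiv p))"]
        assms A pderiv_real_rooted deg
      unfolding sigma_eigval_def sp M_def
      by (simp add: filter_mset_image_mset degree_pderiv)
    have NM: "N \<le> Suc M" "M \<le> N" using positive_roots_le positive_roots_ge N_def M_def by auto
    obtain m where m: "\<And>i. i < m \<Longrightarrow> coeff (pderiv p) i = 0"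
      "sgn (coeff (pderiv p) m) = (-1) ^ M"
      using sgn_lowest_coeff_pderiv deg unfolding M_def by auto
    \<comment> \<open>Differentiation moves coefficient \<open>i + 1\<close> of \<open>p\<close> to
      place \<open>i\<close> with factor \<open>i + 1\<close>. So the lowest nonzero coefficient of
      \<open>pderiv p\<close>, at \<open>m\<close>, marks the last nonzero \<open>sigma\<close>, at
      \<open>n - 1 - m\<close>.\<close>
    have sigma_coeff: "coeff (pderiv p) i = Suc i * sigma (n - 1 - i) A" if "i \<le> n - 1" for i
      using sigma_eq_coeff[OF A, of "n - 1 - i"] that n by (simp add: coeff_pderiv p_def)
    have "coeff (pderiv p) m \<noteq> 0" using m(2) by (metis sgn_0 power_eq_0_iff zero_neq_neg_one)
    then have mn: "m \<le> n - 1" using le_degree deg by (fastforce simp: degree_pderiv)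
    have last: "last_nonzero A = n - 1 - m"
    proof (rule last_nonzero_eq[OF A])
      show "sigma (n - 1 - m) A \<noteq> 0"
        using sigma_coeff[OF mn] \<open>coeff (pderiv p) m \<noteq> 0\<close> by auto
      show "sigma l A = 0" if "n - 1 - m < l" "l \<le> n - 1" for l
      proof -
        have "n - 1 - l < m" "n - 1 - l \<le> n - 1" "n - 1 - (n - 1 - l) = l" using that by auto
        then show ?thesis using sigma_coeff[of "n - 1 - l"] m(1)[of "n - 1 - l"] by simp
      qed
    qed simp
    have sgn_last: "sgn (sigma (last_nonzero A) A) = (-1) ^ M"
      using m(2) unfolding last sigma_coeff[OF mn] by (simp add: sgn_mult)
    have sigma_n: "sigma n A = poly p 0"
      using sigma_eq_coeff[OF A, of n] by (simp add: poly_0_coeff_0 p_def)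
    have sign: "sigma (last_nonzero A) A * sigma n A < 0 \<longleftrightarrow> N = Suc M"
    proof (cases "sigma n A = 0")
      case True
      then show ?thesis using positive_roots_eq_if_zero_root sigma_n by (simp add: N_def M_def)
    next
      case False
      then have "sgn (sigma n A) = (-1) ^ N"
        using sgn_poly_0 deg sigma_n by (simp add: N_def)
      then have "sgn (sigma (last_nonzero A) A * sigma n A) = (-1) ^ (M + N)"
        using sgn_last by (simp add: sgn_mult power_add)
      then have "sigma (last_nonzero A) A * sigma n A < 0 \<longleftrightarrow> odd (M + N)"
        by (simp add: sgn_1_neg[symmetric] minus_one_power_iff)
      \<comment> \<open>Only \<open>N = M\<close> and \<open>N = Suc M\<close> are possible, so
        parity separates them.\<close>
      also have "\<dots> \<longleftrightarrow> N = Suc M" using NM le_antisym[of N M] not_less_eq_eq[of N M] by (auto simp: le_Suc_eq)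
      finally show ?thesis .
    qed
    \<comment> \<open>The difference of the two sets says \<open>k \<le> N < k + 1\<close>; here
      \<open>k \<le> n - 1\<close> puts the index \<open>k + 1\<close> in range.\<close>
    have "A \<in> E_set n k \<longleftrightarrow> N = k \<and> N = Suc M"
      using lam[of k] lam[of "k + 1"] assms sign A by (auto simp: E_set_def)
    \<comment> \<open>If \<open>M < k\<close>, then \<open>N \<le> Suc M \<le> k\<close>, so
      \<open>N < k\<close> or \<open>N = k = Suc M\<close>. Conversely, either case gives
      \<open>M < k\<close>, the first by \<open>M \<le> N\<close>.\<close>
    then show ?thesis using mu lam[of k] assms NM by auto
  qed
  moreover have "Lam_sigma n k \<subseteq> Sym2 n" "Lam n k \<union> E_set n k \<subseteq> Sym2 n"
    by (auto simp: Lam_sigma_def Lam_def E_set_def)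
  ultimately show ?thesis unfolding E_set_def by blast
qed

end
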